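(* Let $f=(f_1,\dots,f_n):\mathbb{R}^n\to\mathbb{R}^n$ be a real polynomial mapping which is $\mathcal{D}_0$, and let $[w,v_1,\dots,v_n]$ be a univariate representation of $\mathrm{Sol}(f)$. Then there exists $\varphi\in\mathbb{R}[t]$ such that $$\mathrm{Sol}_{\ln}(f)=\Big\{\big(v_1(t),\dots,v_n(t)\big): t\in\arg\min\{\varphi(t): w(t)=0,\ t\in\mathbb{R}\}\Big\}.$$
   Context: For a real polynomial mapping $f=(f_1,\dots,f_n):\mathbb{R}^n\to\mathbb{R}^n$, $\mathrm{Sol}(f)$ denotes the solution set of the polynomial complementarity problem $\mathrm{CP}(f)$, i.e. the set of $x\in\mathbb{R}^n$ with $x\ge0$, $f(x)\ge0$ (componentwise) and $\langle x\mid f(x)\rangle=0$ (usual scalar product). A least-norm solution is a minimizer of the Euclidean norm $\|\alpha\|$ over $\alpha\in\mathrm{Sol}(f)$; the set of least-norm solutions is $\mathrm{Sol}_{\ln}(f)$. $f$ is called $\mathcal{D}_0$ if the set $\{x\in\mathbb{C}^n:x_1f_1(x)=\dots=x_nf_n(x)=0\}$ is finite. With $x=(x_1,\dots,x_n)$ and $z=(z_1,\dots,z_{2n})$, $\mathcal{I}[f,z]$ is the ideal of $\mathbb{R}[x,z]$ generated by $x_if_i$, $z_i^2-x_i$, $z_{n+i}^2-f_i$, $i=1,\dots,n$, and $V_{\mathbb{C}}(\mathcal{I}[f,z])\subseteq\mathbb{C}^{3n}$ is its set of common complex zeros. A univariate representation of $\mathrm{Sol}(f)$ (for $f$ being $\mathcal{D}_0$)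 is a system $[w,v_1,\dots,v_n]\subset\mathbb{R}[t]$ with $\deg w=\#V_{\mathbb{C}}(\mathcal{I}[f,z])$, $\deg v_i<\deg w$ for all $i$, and $\mathrm{Sol}(f)=\{(v_1(t),\dots,v_n(t)): w(t)=0,\ t\in\mathbb{R}\}$. *)

theory Defs
  imports
    "HOL-Analysis.Analysis"
    "HOL-Computational_Algebra.Polynomial"
    "HOL-Library.Poly_Mapping"
begin

text \<open>
  Polynomials over \<open>'a\<close> in variables indexed by \<open>'v\<close>: finitely supported maps from exponent
  vectors to coefficients, with the convolution product of \<open>Poly_Mapping\<close>.
\<close>

type_synonym ('v, 'a) mvpoly = "('v \<Rightarrow>\<^sub>0 nat) \<Rightarrow>\<^sub>0 'a"

definition Const :: "'a \<Rightarrow> ('v, 'a::zero) mvpoly" where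
  "Const c = Poly_Mapping.single 0 c"

definition Var :: "'v \<Rightarrow> ('v, 'a::zero_neq_one) mvpoly" where
  "Var i = Poly_Mapping.single (Poly_Mapping.single i 1) 1"

text \<open>
  Substitution of \<open>y i\<close> for the variable \<open>i\<close>, the coefficients being sent to the target ring
  by \<open>h\<close> (meant to be a ring homomorphism).
\<close>

definition msubst ::
  "('a::zero \<Rightarrow> 'b) \<Rightarrow> ('v::finite \<Rightarrow> 'b) \<Rightarrow> ('v, 'a) mvpoly \<Rightarrow> 'b::comm_semiring_1" where
  "msubst h y p =
     (\<Sum>m\<in>Poly_Mapping.keys p.
        h (Poly_Mapping.lookup p m) * (\<Prod>i\<in>UNIV. y i ^ Poly_Mapping.lookup m i))"

definition meval ::
  "('v::finite, real) mvpoly \<Rightarrow> ('b::{real_algebra_1, comm_ring_1}) ^ 'v \<Rightarrow> 'b" where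
  "meval p a = msubst of_real (\<lambda>i. a $ i) p"

definition poly_map :: "('n::finite, real) mvpoly ^ 'n \<Rightarrow> real ^ 'n \<Rightarrow> real ^ 'n" where
  "poly_map f x = (\<chi> i. meval (f $ i) x)"

definition Sol :: "('n::finite, real) mvpoly ^ 'n \<Rightarrow> (real ^ 'n) set" where
  "Sol f = {x. (\<forall>i. 0 \<le> x $ i) \<and> (\<forall>i. 0 \<le> poly_map f x $ i) \<and> x \<bullet> poly_map f x = 0}"

definition Sol_ln :: "('n::finite, real) mvpoly ^ 'n \<Rightarrow> (real ^ 'n) set" where
  "Sol_ln f = {x. is_arg_min norm (\<lambda>a. a \<in> Sol f) x}"

definition is_D0 :: "('n::finite, real) mvpoly ^ 'n \<Rightarrow> bool" where
  "is_D0 f \<longleftrightarrow> finite {x :: complex ^ 'n. \<forall>i. x $ i * meval (f $ i) x = 0}"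

text \<open>
  The \<open>3n\<close> variables of \<open>\<real>[x, z]\<close> are indexed by \<open>'n + ('n + 'n)\<close>: \<open>x\<^sub>i\<close> is \<open>Inl i\<close>,
  \<open>z\<^sub>i\<close> is \<open>Inr (Inl i)\<close> and \<open>z\<^bsub>n+i\<^esub>\<close> is \<open>Inr (Inr i)\<close>.
\<close>

type_synonym 'n xz = "'n + ('n + 'n)"

definition lift_x :: "('n::finite, real) mvpoly \<Rightarrow> ('n xz, real) mvpoly" where
  "lift_x p = msubst Const (\<lambda>i. Var (Inl i)) p"

definition ideal_gens :: "('n::finite, real) mvpoly ^ 'n \<Rightarrow> ('n xz, real) mvpoly set" where
  "ideal_gens f =
     range (\<lambda>i. Var (Inl i) * lift_x (f $ i))
     \<union> range (\<lambda>i. Var (Inr (Inl i)) ^ 2 - Var (Inl i))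
     \<union> range (\<lambda>i. Var (Inr (Inr i)) ^ 2 - lift_x (f $ i))"

text \<open>An ideal is a submodule of the ring viewed as a module over itself.\<close>

definition ideal_fz :: "('n::finite, real) mvpoly ^ 'n \<Rightarrow> ('n xz, real) mvpoly set" where
  "ideal_fz f = module.span (*) (ideal_gens f)"

definition V_complex :: "('v::finite, real) mvpoly set \<Rightarrow> (complex ^ 'v) set" where
  "V_complex I = {a. \<forall>p\<in>I. meval p a = 0}"

definition curve_pt :: "real poly ^ 'n \<Rightarrow> real \<Rightarrow> real ^ 'n" where
  "curve_pt v t = (\<chi> i. poly (v $ i) t)"

text \<open>
  Only used for \<open>f\<close> satisfying \<open>is_D0\<close>: the zero set counted by \<open>card\<close> is then finite.
\<close>

definition is_univariate_rep ::
  "('n::finite, real) mvpoly ^ 'n \<Rightarrow> real poly \<Rightarrow> real poly ^ 'n \<Rightarrow> bool" where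
  "is_univariate_rep f w v \<longleftrightarrow>
     degree w = card (V_complex (ideal_fz f)) \<and>
     (\<forall>i. degree (v $ i) < degree w) \<and>
     Sol f = {curve_pt v t | t. poly w t = 0}"

end

theory Submission
  imports Defs
begin

text \<open>
  The curve \<open>t \<mapsto> (v\<^sub>1(t), \<dots>, v\<^sub>n(t))\<close> maps the real zeros of \<open>w\<close> onto \<open>Sol f\<close>, and along it
  the squared Euclidean norm is the univariate polynomial \<open>\<phi> = v\<^sub>1\<^sup>2 + \<dots> + v\<^sub>n\<^sup>2\<close>. Since squaring
  is increasing on nonnegative reals, minimizing the norm over \<open>Sol f\<close> is minimizing \<open>\<phi>\<close> over
  the real zeros of \<open>w\<close>. The curve may take the same value at several zeros of \<open>w\<close>: all of these
  parameters then have the same value of \<open>\<phi>\<close>, so they are minimizers together.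
\<close>

lemma poly_sum_squares_eq_norm_curve_pt:
  fixes v :: "real poly ^ 'n::finite"
  shows "poly (\<Sum>i\<in>UNIV. (v $ i)\<^sup>2) t = (norm (curve_pt v t))\<^sup>2"
  unfolding power2_norm_eq_inner inner_vec_def by (simp add: poly_sum curve_pt_def power2_eq_square)

lemma is_arg_min_image:
  "{x. is_arg_min g (\<lambda>y. y \<in> c ` T) x} = {c t | t. is_arg_min (\<lambda>s. g (c s)) (\<lambda>s. s \<in> T) t}"
  unfolding is_arg_min_def by blast

theorem theorem4p3:
  fixes f :: "('n::finite, real) mvpoly ^ 'n"
    and w :: "real poly" and v :: "real poly ^ 'n"
  assumes "is_D0 f"
    and "is_univariate_rep f w v"
  shows "\<exists>\<phi> :: real poly.
    Sol_ln f = {curve_pt v t | t. is_arg_min (poly \<phi>) (\<lambda>s. poly w s = 0) t}"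
proof
  let ?\<phi> = "\<Sum>i\<in>UNIV. (v $ i)\<^sup>2"
  have "Sol f = curve_pt v ` {t. poly w t = 0}"
    using assms(2) by (auto simp: is_univariate_rep_def)
  then have "Sol_ln f = {curve_pt v t | t.
      is_arg_min (\<lambda>s. norm (curve_pt v s)) (\<lambda>s. poly w s = 0) t}"
    by (simp add: Sol_ln_def is_arg_min_image)
  moreover have "poly ?\<phi> s < poly ?\<phi> t \<longleftrightarrow> norm (curve_pt v s) < norm (curve_pt v t)" for s t
    unfolding poly_sum_squares_eq_norm_curve_pt by (simp add: power_mono_iff flip: not_le)
  ultimately show "Sol_ln f = {curve_pt v t | t. is_arg_min (poly ?\<phi>) (\<lambda>s. poly w s = 0) t}"
    by (simp only: is_arg_min_def)
qed

end
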